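(* Let $p$ be an odd prime, $m$ a positive integer, $q=p^m$, $s>1$ a positive integer, and $a\in\mu_{q^2+q+1}=\{x\in\mathbb{F}_{q^3}: x^{q^2+q+1}=1\}$. Let $$f_3(X)=2X^{q^2}+(a+a^{2+q})X^q+\left(a^{1+q^2}+a^{2+q^2}\right)X+\mathrm{Tr}_m^{3m}(X)^s\in\mathbb{F}_{q^3}[X].$$ Then: (1) if $q\equiv 0\pmod 3$, $f_3(X)$ is a permutation polynomial of $\mathbb{F}_{q^3}$ if and only if $a$ is a solution of neither of the equations $X^{q+1}+X^q+1=0$ and $X^{q+1}+X+1=0$, and $\gcd(s,q-1)=1$; (2) if $q\equiv 1\pmod 3$, $f_3(X)$ is a permutation polynomial of $\mathbb{F}_{q^3}$ if and only if $a$ is a solution of none of the equations $X^{q+1}-\frac{2}{1+\alpha}X^q+\frac{1-\alpha}{1+\alpha}=0$, $X^{q+1}-\frac{2}{1-\alpha}X^q+\frac{1+\alpha}{1-\alpha}=0$, $X^{q+1}-\frac{2}{1+\beta}X+\frac{1-\beta}{1+\beta}=0$ and $X^{q+1}-\frac{2}{1-\beta}X+\frac{1+\beta}{1-\beta}=0$, where $\alpha,\beta\in\mathbb{F}_{q^3}$ satisfy $\alpha^2=-3=\beta^2$, and $\gcd(s,q-1)=1$; (3) if $q\equiv 2\pmod 3$, $f_3(X)$ is a permutation polynomial of $\mathbb{F}_{q^3}$ if and only if $a\neq 1$ and $\gcd(s,q-1)=1$.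
   Context: $\mathrm{Tr}_m^{3m}(X)=X+X^q+X^{q^2}$ is the relative trace from $\mathbb{F}_{q^3}$ to $\mathbb{F}_q$. A polynomial $f\in\mathbb{F}_{q^3}[X]$ is a permutation polynomial of $\mathbb{F}_{q^3}$ if $c\mapsto f(c)$ is a bijection of $\mathbb{F}_{q^3}$. *)

theory Defs
  imports "HOL-Computational_Algebra.Computational_Algebra" "HOL-Number_Theory.Cong" "HOL-Library.Cardinality"
begin

text \<open>
  The field with \<open>q ^ 3\<close> elements is rendered as an arbitrary type of class \<open>{field, finite}\<close>
  with \<open>CARD('a) = q ^ 3\<close>.
\<close>

definition permutation_polynomial :: "'a :: {field, finite} poly \<Rightarrow> bool" where
  "permutation_polynomial f \<longleftrightarrow> bij (\<lambda>c. poly f c)"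

definition roots_of_one :: "nat \<Rightarrow> 'a :: {field, finite} set" where
  "roots_of_one n = {x. x ^ n = 1}"

text \<open>The relative trace from the field with \<open>q ^ 3\<close> elements to its subfield with \<open>q\<close> elements,
  as a formal polynomial.\<close>

definition trace_poly :: "nat \<Rightarrow> 'a :: {field, finite} poly" where
  "trace_poly q = monom 1 1 + monom 1 q + monom 1 (q ^ 2)"

definition f3 :: "nat \<Rightarrow> nat \<Rightarrow> 'a :: {field, finite} \<Rightarrow> 'a poly" where
  "f3 q s a =
     monom 2 (q ^ 2) + monom (a + a ^ (2 + q)) q
     + monom (a ^ (1 + q ^ 2) + a ^ (2 + q ^ 2)) 1 + trace_poly q ^ s"

end

theory Submission
  imports Defs
begin

text \<open>
  By Hilbert 90 write \<open>a = g ^ (q - 1)\<close> and let \<open>g, h, k\<close> be the conjugates of \<open>g\<close>. The linear part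
  \<open>L\<close> of \<open>f\<^sub>3\<close> is singular: its kernel contains \<open>k (k - g)\<close>, and \<open>Tr (w L(x)) = 0\<close> for
  \<open>w = g (h - k) / h\<close>. Hence \<open>Tr (w f\<^sub>3(x)) = Tr w * Tr x ^ s\<close>, and so \<open>f\<^sub>3\<close> permutes the field iff
  \<open>t \<mapsto> t ^ s\<close> permutes the subfield, \<open>Tr w \<noteq> 0\<close>, and \<open>L\<close> is injective on the trace-zero elements,
  i.e. \<open>Tr (k (k - g)) \<noteq> 0\<close>. Both traces are values of the form
  \<open>u\<^sup>2 + v\<^sup>2 + 1 - u - v - u v = (v + \<omega> u + \<omega>\<^sup>2) (v + \<omega>\<^sup>2 u + \<omega>)\<close>,
  where \<open>\<omega>\<close> is a primitive cube root of unity.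
\<close>

section \<open>Finite fields, and a quadratic form attached to cube roots of unity\<close>

lemma finite_field_power_card:
  fixes x :: "'a :: {field, finite}"
  shows "x ^ CARD('a) = x"
proof (cases "x = 0")
  case True
  then show ?thesis by (simp add: power_0_left)
next
  case False
  let ?U = "UNIV - {0 :: 'a}"
  have "bij_betw ((*) x) ?U ?U"
    by (rule bij_betw_byWitness[where f' = "\<lambda>y. y / x"]) (use False in auto)
  then have "\<Prod>?U = (\<Prod>y\<in>?U. x * y)"
    by (simp add: prod.reindex_bij_betw[where g = "\<lambda>y. y"])
  also have "\<dots> = x ^ card ?U * \<Prod>?U"
    by (simp add: prod.distrib)
  finally have "x ^ card ?U = 1"
    by simp
  moreover have "CARD('a) = Suc (card ?U)"
    by (rule card.remove) simp_all
  ultimately show ?thesis by (simp only: power_Suc mult_1_right)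
qed

text \<open>Translation by \<open>1\<close> permutes the field; summing over all elements shows that
  \<open>CARD('a)\<close> vanishes in it.\<close>

lemma CHAR_eq_of_card_power:
  assumes "CARD('a :: {field, finite}) = p ^ n" "prime p"
  shows "CHAR('a) = p"
proof -
  have "prime CHAR('a)"
    using finite_imp_CHAR_pos[where 'a = 'a] prime_CHAR_semidom[where 'a = 'a] by simp
  moreover have "(\<Sum>x\<in>UNIV. x + 1) = (\<Sum>x\<in>UNIV. x :: 'a)"
    by (rule sum.reindex_bij_witness[of _ "\<lambda>x. x - 1" "\<lambda>x. x + 1"]) auto
  then have "of_nat CARD('a) = (0 :: 'a)"
    by (simp add: sum.distrib)
  then have "CHAR('a) dvd p ^ n"
    using assms(1) by (simp only: of_nat_eq_0_iff_char_dvd)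
  ultimately show ?thesis
    using assms(2) prime_dvd_power primes_dvd_imp_eq by blast
qed

lemma power_eq_one_coprime:
  fixes v :: "'a :: field"
  assumes "v ^ m = 1" "v ^ n = 1" "coprime m n"
  shows "v = 1"
proof (cases "m = 0")
  case True
  then show ?thesis using assms by simp
next
  case False
  then obtain x y where "m * x = n * y + 1"
    using bezout_nat[of m n] assms(3) by auto
  then have "(v ^ m) ^ x = (v ^ n) ^ y * v"
    by (metis power_mult power_add power_one_right)
  then show ?thesis using assms by simp
qed

text \<open>In \<open>x = u - 1\<close> and \<open>y = v - 1\<close> this is
  \<open>x ^ 2 - x * y + y ^ 2\<close>, the norm form of the Eisenstein integers.\<close>

definition norm_form :: "'a :: field \<Rightarrow> 'a \<Rightarrow> 'a" where
  "norm_form u v = u ^ 2 + v ^ 2 + 1 - u - v - u * v"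

text \<open>In characteristic 3 the only cube root of unity is \<open>1\<close>, so the two linear
  factors coincide.\<close>

lemma norm_form_char_3:
  assumes "(3 :: 'a :: field) = 0"
  shows "norm_form u v = 0 \<longleftrightarrow> v + u + (1 :: 'a) = 0"
proof -
  have "norm_form u v = (v + u + 1) ^ 2 - 3 * (u + v + u * v)"
    by (simp add: norm_form_def algebra_simps power2_eq_square)
  then show ?thesis by (simp add: assms)
qed

text \<open>With \<open>\<omega> = (- 1 + \<alpha>) / 2\<close>, a root of
  \<open>X ^ 2 + X + 1\<close>, one has \<open>2 / (1 + \<alpha>) = - \<omega>\<close>, and the two
  equations are the linear factors made monic in \<open>v\<close>.\<close>

lemma norm_form_factor:
  fixes \<alpha> :: "'a :: field"
  assumes \<alpha>: "\<alpha> ^ 2 = - 3" and 2: "(2 :: 'a) \<noteq> 0"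
  shows "norm_form u v = 0 \<longleftrightarrow>
    v - 2 / (1 + \<alpha>) * u + (1 - \<alpha>) / (1 + \<alpha>) = 0 \<or>
    v - 2 / (1 - \<alpha>) * u + (1 + \<alpha>) / (1 - \<alpha>) = 0"
proof -
  have "(1 + \<alpha>) * (1 - \<alpha>) = 2 * 2"
    using \<alpha> by (simp add: algebra_simps power2_eq_square)
  then have nz: "1 + \<alpha> \<noteq> 0" "1 - \<alpha> \<noteq> 0" using 2 by (metis mult_eq_0_iff)+
  have "2 * 2 * norm_form u v =
      ((1 + \<alpha>) * v - 2 * u + (1 - \<alpha>)) * ((1 - \<alpha>) * v - 2 * u + (1 + \<alpha>))"
    unfolding norm_form_def using \<alpha> by algebra
  moreover have
    "v - 2 / (1 + \<alpha>) * u + (1 - \<alpha>) / (1 + \<alpha>) =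
      ((1 + \<alpha>) * v - 2 * u + (1 - \<alpha>)) / (1 + \<alpha>)"
    "v - 2 / (1 - \<alpha>) * u + (1 + \<alpha>) / (1 - \<alpha>) =
      ((1 - \<alpha>) * v - 2 * u + (1 + \<alpha>)) / (1 - \<alpha>)"
    using nz by (simp_all add: add_divide_distrib diff_divide_distrib)
  ultimately show ?thesis
    using 2 nz by (metis divide_eq_0_iff mult_eq_0_iff)
qed

text \<open>A zero other than \<open>(1, 1)\<close> makes \<open>r = - (u - 1) / (v - 1)\<close> a
  root of \<open>X ^ 2 + X + 1\<close>, hence a cube root of unity. The multiplicative group has
  order prime to 3, which leaves \<open>r = 1\<close>, and \<open>3 \<noteq> 0\<close> excludes
  that.\<close>

lemma norm_form_anisotropic:
  fixes u v :: "'a :: {field, finite}"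
  assumes "(3 :: 'a) \<noteq> 0" "coprime 3 (CARD('a) - 1)" "norm_form u v = 0"
  shows "u = 1 \<and> v = 1"
proof -
  have eq: "(u - 1) ^ 2 + (v - 1) ^ 2 = (u - 1) * (v - 1)"
    using assms(3) unfolding norm_form_def by algebra
  show ?thesis
  proof (cases "v = 1")
    case True
    then show ?thesis using eq by simp
  next
    case False
    define r where "r = - (u - 1) / (v - 1)"
    have "u - 1 = - r * (v - 1)" using False by (simp add: r_def)
    with eq have "(v - 1) ^ 2 * (r ^ 2 + r + 1) = 0" by algebra
    then have r: "r ^ 2 + r + 1 = 0" using False by simp
    then have "r ^ 3 = 1" by algebra
    moreover have "r ^ (CARD('a) - 1) = 1"
    proof -
      have "r * r ^ (CARD('a) - 1) = r"
        using finite_field_power_card[of r] by (simp flip: power_Suc)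
      moreover have "r \<noteq> 0" using r by auto
      ultimately show ?thesis by simp
    qed
    ultimately have "r = 1" using assms(2) power_eq_one_coprime by blast
    with r assms(1) show ?thesis by simp
  qed
qed

section \<open>The \<open>q\<close>-power Frobenius and its trace\<close>

locale cubic_extension =
  fixes q :: nat and \<sigma> :: "'a :: {field, finite} \<Rightarrow> 'a"
  assumes card_eq: "CARD('a) = q ^ 3"
    and q_gt_1: "q > 1"
    and \<sigma>_def: "\<sigma> x = x ^ q"
    and \<sigma>_add [simp]: "\<sigma> (x + y) = \<sigma> x + \<sigma> y"
begin

definition tr :: "'a \<Rightarrow> 'a" where
  "tr x = x + \<sigma> x + \<sigma> (\<sigma> x)"

lemma \<sigma>_0 [simp]: "\<sigma> 0 = 0" and \<sigma>_1 [simp]: "\<sigma> 1 = 1"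
  using q_gt_1 by (simp_all add: \<sigma>_def)

lemma \<sigma>_mult [simp]: "\<sigma> (x * y) = \<sigma> x * \<sigma> y"
  by (simp add: \<sigma>_def power_mult_distrib)

lemma \<sigma>_power [simp]: "\<sigma> (x ^ n) = \<sigma> x ^ n"
  by (simp add: \<sigma>_def flip: power_mult) (simp add: mult.commute)

lemma \<sigma>_divide [simp]: "\<sigma> (x / y) = \<sigma> x / \<sigma> y"
  by (simp add: \<sigma>_def power_divide)

lemma \<sigma>_eq_0_iff [simp]: "\<sigma> x = 0 \<longleftrightarrow> x = 0"
  using q_gt_1 by (simp add: \<sigma>_def)

lemma \<sigma>_diff [simp]: "\<sigma> (x - y) = \<sigma> x - \<sigma> y"
  using \<sigma>_add[of "x - y" y] by simp

lemma \<sigma>_numeral [simp]: "\<sigma> (numeral n) = numeral n"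
proof -
  have "\<sigma> (of_nat n) = of_nat n" for n by (induction n) simp_all
  from this[of "numeral n"] show ?thesis by simp
qed

lemma \<sigma>_\<sigma>: "\<sigma> (\<sigma> x) = x ^ (q ^ 2)"
  by (simp add: \<sigma>_def power2_eq_square flip: power_mult)

lemma \<sigma>_cubed [simp]: "\<sigma> (\<sigma> (\<sigma> x)) = x"
  using finite_field_power_card[of x]
  by (simp add: \<sigma>_def card_eq power3_eq_cube flip: power_mult)

lemma \<sigma>_inj: "\<sigma> x = \<sigma> y \<longleftrightarrow> x = y"
  by (metis \<sigma>_cubed)

lemma \<sigma>_tr [simp]: "\<sigma> (tr x) = tr x"
  by (simp add: tr_def)

lemma tr_0 [simp]: "tr 0 = 0"
  by (simp add: tr_def)

lemma tr_add: "tr (x + y) = tr x + tr y"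
  by (simp add: tr_def)

lemma tr_diff: "tr (x - y) = tr x - tr y"
  by (simp add: tr_def)

lemma tr_mult_fixed: "\<sigma> c = c \<Longrightarrow> tr (x * c) = tr x * c"
  by (simp add: tr_def algebra_simps)

lemma poly_trace_poly: "poly (trace_poly q) x = tr x"
  by (simp add: trace_poly_def tr_def poly_monom \<sigma>_\<sigma>) (simp add: \<sigma>_def)

section \<open>Nonvanishing from degree bounds, and Hilbert 90\<close>

lemma ex_poly_nonzero:
  assumes "degree P < q ^ 3" "P \<noteq> 0"
  obtains x :: 'a where "poly P x \<noteq> 0"
proof -
  have "card {x. poly P x = 0} < CARD('a)"
    using card_poly_roots_bound[OF assms(2)] assms(1) card_eq by simp
  then have "{x. poly P x = 0} \<noteq> UNIV" by auto
  then show thesis using that by auto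
qed

lemma degree_less_cube:
  assumes "\<And>i. i > q ^ 2 \<Longrightarrow> coeff P i = 0"
  shows "degree P < q ^ 3"
proof -
  have "degree P \<le> q ^ 2" by (rule degree_le) (use assms in auto)
  also have "q ^ 2 < q ^ 3" using q_gt_1 by (intro power_strict_increasing) auto
  finally show ?thesis .
qed

lemma q_less_q2: "q < q ^ 2"
  using q_gt_1 by (simp add: power2_eq_square)

text \<open>Independence of the powers of the Frobenius: as a polynomial of degree at most
  \<open>q ^ 2\<close> the expression has too few roots to vanish everywhere.\<close>

lemma ex_lin_nonzero:
  obtains y :: 'a where "y + c * \<sigma> y + d * \<sigma> (\<sigma> y) \<noteq> 0"
proof -
  let ?P = "monom 1 1 + monom c q + monom d (q ^ 2) :: 'a poly"
  have "degree ?P < q ^ 3"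
    by (rule degree_less_cube) (use q_gt_1 q_less_q2 in auto)
  moreover have "coeff ?P 1 = 1"
    using q_gt_1 q_less_q2 by simp
  then have "?P \<noteq> 0" by (metis coeff_0 zero_neq_one)
  ultimately obtain y where "poly ?P y \<noteq> 0" by (rule ex_poly_nonzero)
  then show thesis by (intro that[of y]) (simp add: poly_monom \<sigma>_\<sigma>, simp add: \<sigma>_def)
qed

lemma ex_not_fixed: obtains y where "\<sigma> y \<noteq> y"
proof -
  obtain y where "y + (- 1) * \<sigma> y + 0 * \<sigma> (\<sigma> y) \<noteq> 0" by (rule ex_lin_nonzero)
  then show thesis using that[of y] by auto
qed

text \<open>Stands in for surjectivity of the trace onto the fixed field: composing \<open>P\<close>
  with the trace polynomial gives degree at most \<open>(q - 1) * q ^ 2\<close>, too small to vanish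
  everywhere.\<close>

lemma ex_poly_tr_nonzero:
  assumes "P \<noteq> 0" "degree P < q"
  obtains u where "poly P (tr u) \<noteq> 0"
proof -
  have coeff: "coeff (trace_poly q :: 'a poly) i = 0" if "i > q ^ 2" for i
    using that q_gt_1 q_less_q2 by (auto simp: trace_poly_def)
  have deg: "degree (trace_poly q :: 'a poly) \<le> q ^ 2"
    by (rule degree_le) (use coeff in auto)
  have "coeff (trace_poly q :: 'a poly) 1 = 1"
    using q_gt_1 q_less_q2 by (simp add: trace_poly_def)
  then have pos: "degree (trace_poly q :: 'a poly) > 0"
    by (metis le_degree less_le_trans zero_less_one zero_neq_one)
  have "degree (P \<circ>\<^sub>p trace_poly q) \<le> degree P * q ^ 2"
    using deg by (simp add: degree_pcompose)
  also have "\<dots> < q * q ^ 2" using assms(2) q_gt_1 by simp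
  finally have "degree (P \<circ>\<^sub>p trace_poly q) < q ^ 3"
    by (simp add: power3_eq_cube power2_eq_square)
  moreover have "P \<circ>\<^sub>p trace_poly q \<noteq> 0"
    using pcompose_eq_0[OF _ pos] assms(1) by blast
  ultimately obtain u where "poly (P \<circ>\<^sub>p trace_poly q) u \<noteq> 0"
    by (rule ex_poly_nonzero)
  then show thesis using that by (simp add: poly_pcompose poly_trace_poly)
qed

lemma hilbert_90:
  assumes "a * \<sigma> a * \<sigma> (\<sigma> a) = 1"
  obtains g where "g \<noteq> 0" "\<sigma> g = a * g"
proof -
  have nz: "a \<noteq> 0" "\<sigma> a \<noteq> 0" using assms by auto
  \<comment> \<open>The Lagrange resolvent of \<open>y\<close>, which \<open>\<sigma>\<close>
    multiplies by \<open>a\<close>.\<close>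
  obtain y where y: "y + (1 / a) * \<sigma> y + (1 / (a * \<sigma> a)) * \<sigma> (\<sigma> y) \<noteq> 0"
    by (rule ex_lin_nonzero)
  have "1 / (\<sigma> a * \<sigma> (\<sigma> a)) = a"
    using assms nz by (simp add: field_simps)
  then have "\<sigma> (y + (1 / a) * \<sigma> y + (1 / (a * \<sigma> a)) * \<sigma> (\<sigma> y))
      = \<sigma> y + (1 / \<sigma> a) * \<sigma> (\<sigma> y) + a * y"
    by simp (metis divide_inverse inverse_eq_divide mult.commute)
  also have "\<dots> = a * (y + (1 / a) * \<sigma> y + (1 / (a * \<sigma> a)) * \<sigma> (\<sigma> y))"
    using nz by (simp add: field_simps)
  finally show thesis by (rule that[OF y])
qed

section \<open>The linear part of \<open>f3\<close> and its trace-zero kernel\<close>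

definition lin :: "'a \<Rightarrow> 'a \<Rightarrow> 'a" where
  "lin a x = 2 * \<sigma> (\<sigma> x) + (a + a ^ 2 * \<sigma> a) * \<sigma> x + (a * \<sigma> (\<sigma> a) + a ^ 2 * \<sigma> (\<sigma> a)) * x"

lemma lin_diff: "lin a (x - y) = lin a x - lin a y"
  by (simp add: lin_def algebra_simps)

lemma lin_0 [simp]: "lin a 0 = 0"
  by (simp add: lin_def)

lemma poly_f3: "poly (f3 q s a) x = lin a x + tr x ^ s"
  by (simp add: f3_def lin_def poly_monom poly_trace_poly power_add power2_eq_square[of a] \<sigma>_\<sigma>)
    (simp add: \<sigma>_def mult.assoc)

lemma tr_eq_0_nontrivial: obtains z where "z \<noteq> 0" "tr z = 0"
proof -
  obtain y where "\<sigma> y \<noteq> y" by (rule ex_not_fixed)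
  then show thesis by (intro that[of "\<sigma> y - y"]) (auto simp: tr_def)
qed

text \<open>On trace-zero elements \<open>f3\<close> agrees with \<open>lin\<close>, so such a
  kernel element collides with \<open>0\<close>.\<close>

lemma f3_inj_imp:
  assumes "permutation_polynomial (f3 q s a)" "s > 0" "lin a z = 0" "tr z = 0"
  shows "z = 0"
proof -
  have "poly (f3 q s a) z = poly (f3 q s a) 0"
    using assms by (simp add: poly_f3 power_0_left)
  then show ?thesis
    using assms(1) unfolding permutation_polynomial_def by (simp add: bij_def inj_eq)
qed

lemma not_permutation_1:
  assumes "s > 0"
  shows "\<not> permutation_polynomial (f3 q s (1 :: 'a))"
proof
  assume perm: "permutation_polynomial (f3 q s (1 :: 'a))"
  obtain z :: 'a where z: "z \<noteq> 0" "tr z = 0" by (rule tr_eq_0_nontrivial)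
  have "lin 1 z = 2 * tr z" by (simp add: lin_def tr_def algebra_simps)
  with z perm assms show False using f3_inj_imp by auto
qed

section \<open>Power maps on the fixed field of \<open>\<sigma>\<close>\<close>

lemma fixed_power_inj:
  assumes "\<sigma> t = t" "\<sigma> u = u" "t ^ s = u ^ s" "coprime s (q - 1)" "s > 0"
  shows "t = u"
proof (cases "u = 0")
  case True
  then show ?thesis using assms by (simp add: power_0_left)
next
  case False
  \<comment> \<open>A nonzero fixed element has order dividing \<open>q - 1\<close>; that of
    \<open>t / u\<close> also divides \<open>s\<close>.\<close>
  have "(t / u) ^ (q - 1) * (t / u) = (t / u) ^ q"
    by (rule power_minus_mult) (use q_gt_1 in simp)
  also have "\<dots> = t / u"
    using assms(1,2) by (simp add: \<sigma>_def power_divide)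
  finally have "(t / u) ^ (q - 1) * (t / u) = t / u" .
  moreover have "t \<noteq> 0" using assms False by (auto simp: power_0_left)
  ultimately have "(t / u) ^ (q - 1) = 1" using False by auto
  moreover have "(t / u) ^ s = 1" using assms False by (simp add: power_divide)
  ultimately have "t / u = 1" using assms(4) power_eq_one_coprime by blast
  then show ?thesis using False by simp
qed

text \<open>
  If \<open>gcd s (q - 1) = d > 1\<close>, then every value \<open>t\<close> of the trace would satisfy
  \<open>t ^ ((q - 1) div d + 1) = C ^ ((q - 1) div d) * t\<close>, an equation of degree less than \<open>q\<close>.
\<close>

lemma trace_powers_surj_imp:
  assumes rep: "\<And>u. \<exists>t. \<sigma> t = t \<and> tr u = C * t ^ s" and "s > 0"
  shows "C \<noteq> 0" "coprime s (q - 1)"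
proof -
  show "C \<noteq> 0"
  proof
    assume "C = 0"
    \<comment> \<open>For \<open>C = 0\<close> the trace would vanish identically, so the polynomial
      \<open>X\<close> refutes it.\<close>
    moreover have "monom (1 :: 'a) 1 \<noteq> 0" "degree (monom (1 :: 'a) 1) < q"
      using q_gt_1 by (simp_all add: degree_monom_eq monom_eq_0_iff)
    then obtain u where "poly (monom 1 1) (tr u) \<noteq> 0"
      using ex_poly_tr_nonzero by blast
    ultimately show False using rep[of u] by (auto simp: poly_monom)
  qed
  show "coprime s (q - 1)"
  proof (rule ccontr)
    define d where "d = gcd s (q - 1)"
    define n where "n = (q - 1) div d"
    assume "\<not> coprime s (q - 1)"
    then have "d \<noteq> 1" by (simp add: d_def coprime_iff_gcd_eq_1)
    moreover have "d > 0" using \<open>s > 0\<close> by (simp add: d_def)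
    ultimately have d: "d \<ge> 2" by simp
    have dn: "d * n = q - 1" by (simp add: n_def d_def)
    have n: "n > 0" using dn q_gt_1 by (cases n) auto
    \<comment> \<open>Since \<open>d \<ge> 2\<close>, one gets \<open>n + 1 \<le> 2 * n < q\<close>,
      the required degree bound.\<close>
    have "2 * n \<le> q - 1" using d dn by (metis mult_le_mono1)
    then have n': "n + 1 < q" using n by simp
    obtain e where e: "s = d * e" by (metis d_def dvdE gcd_dvd1)
    let ?P = "monom 1 (n + 1) - monom (C ^ n) 1 :: 'a poly"
    have "degree ?P < q"
      by (rule degree_lessI) (use n' in auto)
    moreover have "coeff ?P (n + 1) = 1" using n by simp
    then have "?P \<noteq> 0" by (metis coeff_0 zero_neq_one)
    ultimately obtain u where u: "poly ?P (tr u) \<noteq> 0"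
      using ex_poly_tr_nonzero by blast
    obtain t where t: "\<sigma> t = t" "tr u = C * t ^ s" using rep by blast
    show False
    proof (cases "t = 0")
      case True
      then show False using u t \<open>s > 0\<close> by (simp add: poly_monom power_0_left)
    next
      case False
      have "t ^ (q - 1) * t = t"
        using q_gt_1 t(1) power_minus_mult[of q t] by (simp add: \<sigma>_def)
      then have "t ^ (q - 1) = 1" using False by simp
      \<comment> \<open>Here \<open>s * n = e * (q - 1)\<close>.\<close>
      then have "(t ^ s) ^ n = 1"
        by (metis e dn power_mult power_one mult.assoc mult.commute)
      then show False using u t by (simp add: poly_monom power_mult_distrib)
    qed
  qed
qed

section \<open>The criterion in terms of the conjugates \<open>g\<close>, \<open>h\<close>,
  \<open>k\<close>\<close>

context
  fixes a g h k w :: 'a and s :: nat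
  assumes g: "g \<noteq> 0" and h: "h = \<sigma> g" and k: "k = \<sigma> h" and a: "a = h / g"
    and w: "w = g * (h - k) / h"
begin

lemma conjugates: "h \<noteq> 0" "k \<noteq> 0" "\<sigma> g = h" "\<sigma> h = k" "\<sigma> k = g"
  using g by (simp_all add: h k)

lemma lin_conjugates:
  "lin a x = 2 * \<sigma> (\<sigma> x) + h * (g + k) / g ^ 2 * \<sigma> x + h * (g + h) / (g * k) * x"
  using g conjugates unfolding lin_def a
  by (simp add: field_simps power2_eq_square)

lemma tr_w_lin: "tr (w * lin a x) = 0"
  unfolding lin_conjugates tr_def w
  using g conjugates by (simp add: divide_simps) (simp add: algebra_simps power2_eq_square)

lemma lin_kernel: "lin a (k * (k - g)) = 0"
  unfolding lin_conjugates
  using g conjugates by (simp add: divide_simps) (simp add: algebra_simps power2_eq_square)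

text \<open>Put \<open>Q(x, y, z) = x^2 + y^2 + z^2 - x y - y z - z x\<close>, so that
  \<open>norm_form u v = Q(1, u, v)\<close>. Then \<open>tr w\<close> is
  \<open>- g h k Q(1/g, 1/h, 1/k)\<close>, while the trace of the kernel element is
  \<open>Q(g, h, k)\<close>.\<close>

lemma tr_w: "tr w = - norm_form (\<sigma> a) (a * \<sigma> a) * (g * h / k)"
  unfolding tr_def w a norm_form_def
  using g conjugates by (simp add: divide_simps) (simp add: algebra_simps power2_eq_square)

lemma tr_kernel: "tr (k * (k - g)) = norm_form a (a * \<sigma> a) * g ^ 2"
  unfolding tr_def a norm_form_def
  using g conjugates by (simp add: divide_simps) (simp add: algebra_simps power2_eq_square)

text \<open>
  The equations \<open>lin a x = 0\<close> and \<open>\<sigma> (lin a x) = 0\<close> in \<open>x, \<sigma> x, \<sigma> (\<sigma> x)\<close> determine these up to a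
  factor, hence make them proportional to the conjugates of \<open>k * (k - g)\<close>.
\<close>

lemma lin_eq_0_imp:
  assumes "lin a x = 0" "tr x = 0" "h \<noteq> g" "tr (k * (k - g)) \<noteq> 0"
  shows "x = 0"
proof -
  have nz: "h \<noteq> g" "h \<noteq> k" "k \<noteq> g"
    using assms(3) \<sigma>_inj conjugates by metis+
  define y z where "y = \<sigma> x" and "z = \<sigma> y"
  have \<sigma>: "\<sigma> x = y" "\<sigma> y = z" "\<sigma> z = x" by (simp_all add: y_def z_def)
  have E1: "2 * g ^ 2 * k * z + h * k * (g + k) * y + g * h * (g + h) * x = 0"
    using assms(1) g conjugates unfolding lin_conjugates
    by (simp add: divide_simps \<sigma>) algebra
  have E2: "2 * h ^ 2 * g * x + k * g * (h + g) * z + h * k * (h + k) * y = 0"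
    using arg_cong[OF E1, of \<sigma>] by (simp add: \<sigma> conjugates)
  have T: "x + y + z = 0" using assms(2) by (simp add: tr_def \<sigma>)
  have P: "x * (g * (g - h)) = y * (k * (k - g))"
  proof -
    \<comment> \<open>This is \<open>g * k\<close> times the combination
      \<open>(h + g) * E1 - 2 * g * E2\<close>, which eliminates \<open>z\<close>.\<close>
    have "g * h * k * (g - h) * (x * (g * (g - h)) - y * (k * (k - g))) = 0"
      using E1 E2 by algebra
    then show ?thesis using nz g conjugates by simp
  qed
  have "y * (h * (h - k)) = z * (g * (g - h))"
    using arg_cong[OF P, of \<sigma>] by (simp add: \<sigma> conjugates)
  \<comment> \<open>By proportionality,
    \<open>x * tr (k * (k - g)) = k * (k - g) * tr x\<close>.\<close>
  with P T nz g conjugates have "x * tr (k * (k - g)) = 0"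
    unfolding tr_def by simp algebra
  then show ?thesis using assms(4) by simp
qed


lemma f3_permutation_iff_conjugates:
  assumes s: "s > 1"
  shows "permutation_polynomial (f3 q s a) \<longleftrightarrow>
    norm_form a (a * \<sigma> a) \<noteq> 0 \<and> norm_form (\<sigma> a) (a * \<sigma> a) \<noteq> 0 \<and> coprime s (q - 1)"
proof (cases "h = g")
  \<comment> \<open>Here \<open>w\<close> and \<open>k * (k - g)\<close> both vanish, so the general
    argument breaks down.\<close>
  case True
  then have "a = 1" using a g by simp
  moreover have "norm_form 1 (1 :: 'a) = 0" by (simp add: norm_form_def)
  ultimately show ?thesis using not_permutation_1 s by simp
next
  case hg: False
  then have nz: "h \<noteq> k" "k \<noteq> g"
    using \<sigma>_inj conjugates by metis+
  have tr_wf: "tr (w * poly (f3 q s a) x) = tr w * tr x ^ s" for x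
    by (simp add: poly_f3 distrib_left tr_add tr_w_lin tr_mult_fixed)
  show ?thesis
  proof
    assume perm: "permutation_polynomial (f3 q s a)"
    have "tr (k * (k - g)) \<noteq> 0"
      using f3_inj_imp[OF perm _ lin_kernel] s nz conjugates by auto
    \<comment> \<open>A preimage \<open>x\<close> of \<open>u / w\<close> under \<open>f3\<close>
      yields \<open>t = tr x\<close>.\<close>
    moreover have "\<exists>t. \<sigma> t = t \<and> tr u = tr w * t ^ s" for u
    proof -
      have "surj (poly (f3 q s a))"
        using perm by (simp add: permutation_polynomial_def bij_def)
      then obtain x where "poly (f3 q s a) x = u / w" by (metis surjD)
      moreover have "w \<noteq> 0" using w nz g conjugates by simp
      ultimately show ?thesis using tr_wf[of x] by (intro exI[of _ "tr x"]) simp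
    qed
    then have "tr w \<noteq> 0" "coprime s (q - 1)"
      using trace_powers_surj_imp s by (meson less_trans zero_less_one)+
    ultimately show "norm_form a (a * \<sigma> a) \<noteq> 0 \<and> norm_form (\<sigma> a) (a * \<sigma> a) \<noteq> 0 \<and>
        coprime s (q - 1)"
      by (auto simp: tr_w tr_kernel)
  next
    assume "norm_form a (a * \<sigma> a) \<noteq> 0 \<and> norm_form (\<sigma> a) (a * \<sigma> a) \<noteq> 0 \<and> coprime s (q - 1)"
    then have nz': "tr (k * (k - g)) \<noteq> 0" "tr w \<noteq> 0" and cop: "coprime s (q - 1)"
      using g conjugates by (auto simp: tr_w tr_kernel)
    \<comment> \<open>Equal values force equal \<open>s\<close>-th powers of the traces, hence equal
      traces; the difference is then a trace-zero element of the kernel of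
      \<open>lin\<close>.\<close>
    have "inj (poly (f3 q s a))"
    proof (rule injI)
      fix x y
      assume eq: "poly (f3 q s a) x = poly (f3 q s a) y"
      then have "tr x ^ s = tr y ^ s"
        using tr_wf[of x] tr_wf[of y] nz' by simp
      then have tr: "tr x = tr y"
        using fixed_power_inj[of "tr x" "tr y"] cop s by simp
      then have "lin a (x - y) = 0" "tr (x - y) = 0"
        using eq by (simp_all add: poly_f3 lin_diff tr_diff)
      then have "x - y = 0" using lin_eq_0_imp hg nz' by blast
      then show "x = y" by simp
    qed
    then show "permutation_polynomial (f3 q s a)"
      by (simp add: permutation_polynomial_def bij_def finite_UNIV_inj_surj)
  qed
qed

end

section \<open>Return to the parameter \<open>a\<close>, and the residue classes of \<open>q\<close>
  modulo 3\<close>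

lemma f3_permutation_iff:
  fixes a :: 'a
  assumes "a ^ (q ^ 2 + q + 1) = 1" "s > 1"
  shows "permutation_polynomial (f3 q s a) \<longleftrightarrow>
    norm_form a (a ^ (q + 1)) \<noteq> 0 \<and> norm_form (a ^ q) (a ^ (q + 1)) \<noteq> 0 \<and> coprime s (q - 1)"
proof -
  \<comment> \<open>The hypothesis says that \<open>a\<close> has norm \<open>1\<close>, as Hilbert
    90 requires.\<close>
  have "a * \<sigma> a * \<sigma> (\<sigma> a) = 1"
    unfolding \<sigma>_\<sigma> using assms(1) by (simp add: \<sigma>_def power_add mult_ac)
  then obtain g where g: "g \<noteq> 0" "\<sigma> g = a * g" by (rule hilbert_90)
  then have "a = \<sigma> g / g" by simp
  from f3_permutation_iff_conjugates[OF g(1) refl refl this refl assms(2)] show ?thesis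
    by (simp add: \<sigma>_def mult.commute)
qed

end

theorem theorem3p3:
  fixes p m q s :: nat and a :: "'a :: {field, finite}"
  assumes "prime p" and "odd p" and "m > 0" and "q = p ^ m" and "s > 1"
    and "CARD('a) = q ^ 3"
    and "a \<in> roots_of_one (q ^ 2 + q + 1)"
  shows
    "([q = 0] (mod 3) \<longrightarrow>
        (permutation_polynomial (f3 q s a) \<longleftrightarrow>
           a ^ (q + 1) + a ^ q + 1 \<noteq> 0 \<and>
           a ^ (q + 1) + a + 1 \<noteq> 0 \<and>
           gcd s (q - 1) = 1)) \<and>
     ([q = 1] (mod 3) \<longrightarrow>
        (\<forall>\<alpha> \<beta> :: 'a. \<alpha> ^ 2 = - 3 \<and> \<beta> ^ 2 = - 3 \<longrightarrow>
           (permutation_polynomial (f3 q s a) \<longleftrightarrow>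
              a ^ (q + 1) - 2 / (1 + \<alpha>) * a ^ q + (1 - \<alpha>) / (1 + \<alpha>) \<noteq> 0 \<and>
              a ^ (q + 1) - 2 / (1 - \<alpha>) * a ^ q + (1 + \<alpha>) / (1 - \<alpha>) \<noteq> 0 \<and>
              a ^ (q + 1) - 2 / (1 + \<beta>) * a + (1 - \<beta>) / (1 + \<beta>) \<noteq> 0 \<and>
              a ^ (q + 1) - 2 / (1 - \<beta>) * a + (1 + \<beta>) / (1 - \<beta>) \<noteq> 0 \<and>
              gcd s (q - 1) = 1))) \<and>
     ([q = 2] (mod 3) \<longrightarrow>
        (permutation_polynomial (f3 q s a) \<longleftrightarrow> a \<noteq> 1 \<and> gcd s (q - 1) = 1))"
proof -
  have card: "CARD('a) = p ^ (m * 3)"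
    using assms(4,6) by (simp add: power_mult)
  have char: "CHAR('a) = p" by (rule CHAR_eq_of_card_power[OF card assms(1)])
  have "q > 1"
    unfolding assms(4) using prime_gt_1_nat[OF assms(1)] assms(3) by (rule one_less_power)
  moreover have "(x + y) ^ q = x ^ q + y ^ q" for x y :: 'a
    using freshmans_dream'[where 'a = 'a] char assms(1,4) by simp
  ultimately interpret cubic_extension q "\<lambda>x :: 'a. x ^ q"
    using assms(6) by unfold_locales simp_all
  have iff: "permutation_polynomial (f3 q s a) \<longleftrightarrow>
      norm_form a (a ^ (q + 1)) \<noteq> 0 \<and> norm_form (a ^ q) (a ^ (q + 1)) \<noteq> 0 \<and> gcd s (q - 1) = 1"
    using f3_permutation_iff[of a s] assms(5,7)
    by (simp add: roots_of_one_def coprime_iff_gcd_eq_1)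
  have numeral_eq_0: "numeral n = (0 :: 'a) \<longleftrightarrow> p dvd numeral n" for n
    using of_nat_eq_0_iff_char_dvd[of "numeral n", where 'a = 'a] char by simp
  have 2: "(2 :: 'a) \<noteq> 0"
    using assms(1,2) primes_dvd_imp_eq[OF assms(1) two_is_prime_nat]
    by (auto simp: numeral_eq_0)
  have 3: "(3 :: 'a) = 0 \<longleftrightarrow> [q = 0] (mod 3)"
  proof -
    have "prime (3 :: nat)" by simp
    then have "p dvd 3 \<longleftrightarrow> 3 dvd p"
      using primes_dvd_imp_eq assms(1) by (metis dvd_refl)
    also have "\<dots> \<longleftrightarrow> 3 dvd q"
      using assms(3,4) \<open>prime 3\<close> by (simp add: prime_dvd_power_iff)
    finally show ?thesis by (simp add: numeral_eq_0 cong_0_iff)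
  qed
  \<comment> \<open>As \<open>q ^ 3 - 1\<close> is prime to 3, the form vanishes only at
    \<open>(1, 1)\<close>; \<open>a ^ q = 1\<close> gives \<open>a = 1\<close> because the Frobenius
    is injective.\<close>
  have case2: "norm_form a (a ^ (q + 1)) \<noteq> 0 \<and> norm_form (a ^ q) (a ^ (q + 1)) \<noteq> 0 \<longleftrightarrow> a \<noteq> 1"
    if q: "[q = 2] (mod 3)"
  proof -
    have "\<not> 3 dvd n - 1" if "n mod 3 = 2" for n :: nat
      using that by presburger
    moreover have "q ^ 3 mod 3 = 2"
      using cong_pow[OF q, of 3] by (simp add: cong_def)
    ultimately have "\<not> 3 dvd q ^ 3 - 1" by blast
    then have "coprime 3 (CARD('a) - 1)"
      using assms(6) by (simp add: prime_imp_coprime)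
    moreover have "(3 :: 'a) \<noteq> 0"
      using q by (simp add: 3 cong_def)
    ultimately have aniso: "u = 1" if "norm_form u v = 0" for u v :: 'a
      using norm_form_anisotropic that by blast
    show ?thesis
      using aniso[of a "a ^ (q + 1)"] aniso[of "a ^ q" "a ^ (q + 1)"] \<sigma>_inj[of a 1]
      by (auto simp: norm_form_def)
  qed
  show ?thesis
    unfolding iff
  proof (intro conjI impI allI)
    assume "[q = 0] (mod 3)"
    then show "norm_form a (a ^ (q + 1)) \<noteq> 0 \<and> norm_form (a ^ q) (a ^ (q + 1)) \<noteq> 0 \<and>
        gcd s (q - 1) = 1 \<longleftrightarrow>
        a ^ (q + 1) + a ^ q + 1 \<noteq> 0 \<and> a ^ (q + 1) + a + 1 \<noteq> 0 \<and> gcd s (q - 1) = 1"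
      using norm_form_char_3 3 by blast
  next
    \<comment> \<open>\<open>\<alpha>\<close> factors the form at \<open>a ^ q\<close> and
      \<open>\<beta>\<close> the form at \<open>a\<close>. Each pair of equations contains both
      signs of the root, so any choice of roots gives the same condition.\<close>
    fix \<alpha> \<beta> :: 'a
    assume "\<alpha> ^ 2 = - 3 \<and> \<beta> ^ 2 = - 3"
    then show "norm_form a (a ^ (q + 1)) \<noteq> 0 \<and> norm_form (a ^ q) (a ^ (q + 1)) \<noteq> 0 \<and>
        gcd s (q - 1) = 1 \<longleftrightarrow>
        a ^ (q + 1) - 2 / (1 + \<alpha>) * a ^ q + (1 - \<alpha>) / (1 + \<alpha>) \<noteq> 0 \<and>
        a ^ (q + 1) - 2 / (1 - \<alpha>) * a ^ q + (1 + \<alpha>) / (1 - \<alpha>) \<noteq> 0 \<and>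
        a ^ (q + 1) - 2 / (1 + \<beta>) * a + (1 - \<beta>) / (1 + \<beta>) \<noteq> 0 \<and>
        a ^ (q + 1) - 2 / (1 - \<beta>) * a + (1 + \<beta>) / (1 - \<beta>) \<noteq> 0 \<and>
        gcd s (q - 1) = 1"
      using norm_form_factor[of \<alpha> "a ^ q" "a ^ (q + 1)"] norm_form_factor[of \<beta> a "a ^ (q + 1)"] 2
      by blast
  next
    assume "[q = 2] (mod 3)"
    then show "norm_form a (a ^ (q + 1)) \<noteq> 0 \<and> norm_form (a ^ q) (a ^ (q + 1)) \<noteq> 0 \<and>
        gcd s (q - 1) = 1 \<longleftrightarrow> a \<noteq> 1 \<and> gcd s (q - 1) = 1"
      using case2 by blast
  qed
qed

end
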